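(* Let $p\neq q$ be odd primes, $r,l\ge 1$ integers, $n=p^rq^l$ and $m=\phi(n)$. Then $$\mathrm{Cond}(V_{\Phi_n})\le 2\,\phi(\mathrm{rad}(n))\,m^2.$$
   Context: $\phi$ is Euler's totient, $\mathrm{rad}(n)$ is the product of the distinct primes dividing $n$, $\Phi_n$ is the $n$-th cyclotomic polynomial, of degree $m=\phi(n)$, and $\zeta_1,\dots,\zeta_m\in\mathbb{C}$ are the primitive $n$-th roots of unity (in any fixed order). $V_{\Phi_n}$ is the $m\times m$ Vandermonde matrix whose $(i,j)$ entry is $\zeta_i^{\,j-1}$, $1\le i,j\le m$. For a complex matrix $A=(a_{ij})$, $\|A\|=\sqrt{\sum_{i,j}|a_{ij}|^2}$ is the Frobenius norm, and for invertible $A$, $\mathrm{Cond}(A)=\|A\|\,\|A^{-1}\|$. *)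

theory Defs
  imports
    Complex_Main
    "HOL-Computational_Algebra.Primes"
    "HOL-Number_Theory.Totient"
    "Jordan_Normal_Form.Gauss_Jordan_Elimination"
begin

definition rad :: "nat \<Rightarrow> nat" where
  "rad n = \<Prod>(prime_factors n)"

definition primitive_roots_unity :: "nat \<Rightarrow> complex set" where
  "primitive_roots_unity n = {z. z ^ n = 1 \<and> (\<forall>k. 0 < k \<and> k < n \<longrightarrow> z ^ k \<noteq> 1)}"

text \<open>Rows and columns are numbered from 0, so the usual exponent \<open>j - 1\<close> becomes \<open>j\<close>.\<close>

definition vandermonde_mat :: "nat \<Rightarrow> (nat \<Rightarrow> complex) \<Rightarrow> complex mat" where
  "vandermonde_mat m \<zeta> = mat m m (\<lambda>(i, j). \<zeta> i ^ j)"

definition frobenius_norm :: "complex mat \<Rightarrow> real" where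
  "frobenius_norm A = sqrt (\<Sum>i<dim_row A. \<Sum>j<dim_col A. (cmod (A $$ (i, j)))\<^sup>2)"

text \<open>Meaningful for invertible \<open>A\<close> only: otherwise \<open>mat_inverse A\<close> is \<open>None\<close>.\<close>

definition mat_cond :: "complex mat \<Rightarrow> real" where
  "mat_cond A = frobenius_norm A * frobenius_norm (the (mat_inverse A))"

end

theory Submission
  imports
    Defs
    "HOL-Computational_Algebra.Fundamental_Theorem_Algebra"
    "Jordan_Normal_Form.Determinant"
begin

text \<open>All entries of $V$ are unimodular, so $\Vert V \Vert = m$. The entries of $V^{-1}$ are the
  coefficients of $\Phi_n(x) / (x - \zeta_i)$ divided by $\Phi_n'(\zeta_i)$; if the coefficients of
  $\Phi_n$ are at most $c$ in modulus and $|\Phi_n'(\zeta_i)| \ge d$, they are at most $m c / d$.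
  By symmetry let $p < q$, and put $n = p q s$. The identity
  $\Phi_n \cdot (x^{ps} - 1)(x^{qs} - 1) = (x^n - 1)(x^s - 1)$ gives $c = p$ and $d = q s / 2$, so
  $m c / d = 2 \phi(pq) p / q < 2 \phi(pq)$.\<close>

section \<open>Inverting Vandermonde matrices\<close>

text \<open>A right inverse of a square matrix is two-sided, so \<open>A\<close> is a unit and
  \<open>None\<close> is impossible; associativity then identifies the computed inverse with
  \<open>B\<close>. This lets \<open>mat_cond\<close> be evaluated on an explicit inverse.\<close>

lemma mat_inverse_eq_Some:
  fixes A B :: "'a::field mat"
  assumes "A \<in> carrier_mat n n" "B \<in> carrier_mat n n" "A * B = 1\<^sub>m n"
  shows "mat_inverse A = Some B"
proof (cases "mat_inverse A")
  case None
  have "B * A = 1\<^sub>m n"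
    using mat_mult_left_right_inverse[OF assms] .
  then have "A \<in> Units (ring_mat TYPE('a) n ())"
    using assms by (auto simp: Units_def ring_mat_def)
  then show ?thesis
    using mat_inverse(1)[OF assms(1) None, of "()"] by simp
next
  case (Some C)
  have C: "C * A = 1\<^sub>m n" "C \<in> carrier_mat n n"
    using mat_inverse(2)[OF assms(1) Some] by auto
  have "C = C * (A * B)"
    using assms C by simp
  also have "\<dots> = (C * A) * B"
    by (rule assoc_mult_mat[symmetric]) (use assms C in auto)
  also have "\<dots> = B"
    using assms C by simp
  finally show ?thesis
    using Some by simp
qed

lemma frobenius_norm_le:
  assumes "A \<in> carrier_mat n n" "0 \<le> c"
    and "\<And>i j. i < n \<Longrightarrow> j < n \<Longrightarrow> cmod (A $$ (i, j)) \<le> c"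
  shows "frobenius_norm A \<le> real n * c"
proof -
  have "(\<Sum>i<n. \<Sum>j<n. (cmod (A $$ (i, j)))\<^sup>2) \<le> (\<Sum>i<n. \<Sum>j<n. c\<^sup>2)"
    using assms by (intro sum_mono power_mono) auto
  also have "\<dots> = (real n * c)\<^sup>2"
    by (simp add: power2_eq_square)
  finally show ?thesis
    using assms by (auto simp: frobenius_norm_def intro!: real_le_lsqrt)
qed

text \<open>Row \<open>k\<close> of the Vandermonde matrix, applied to the coefficients of a
  polynomial of degree below \<open>m\<close>, evaluates it at \<open>\<zeta> k\<close>. A Lagrange
  basis \<open>G\<close> therefore yields the identity matrix.\<close>

lemma vandermonde_mat_inverse:
  fixes \<zeta> :: "nat \<Rightarrow> complex"
  assumes G: "\<And>i. i < m \<Longrightarrow> degree (G i) < m"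
    and diag: "\<And>i. i < m \<Longrightarrow> poly (G i) (\<zeta> i) = 1"
    and off: "\<And>i k. i < m \<Longrightarrow> k < m \<Longrightarrow> k \<noteq> i \<Longrightarrow> poly (G i) (\<zeta> k) = 0"
  shows "vandermonde_mat m \<zeta> * mat m m (\<lambda>(j, i). coeff (G i) j) = 1\<^sub>m m"
proof (rule eq_matI)
  fix k i assume "k < dim_row (1\<^sub>m m :: complex mat)" "i < dim_col (1\<^sub>m m :: complex mat)"
  then have ki: "k < m" "i < m" by auto
  have "poly (G i) (\<zeta> k) = (\<Sum>j\<le>degree (G i). coeff (G i) j * \<zeta> k ^ j)"
    by (rule poly_altdef)
  also have "\<dots> = (\<Sum>j<m. coeff (G i) j * \<zeta> k ^ j)"
    using G[OF ki(2)] by (intro sum.mono_neutral_left) (auto simp: coeff_eq_0)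
  also have "\<dots> = (vandermonde_mat m \<zeta> * mat m m (\<lambda>(j, i). coeff (G i) j)) $$ (k, i)"
    using ki by (simp add: vandermonde_mat_def scalar_prod_def atLeast0LessThan mult.commute)
  finally show "(vandermonde_mat m \<zeta> * mat m m (\<lambda>(j, i). coeff (G i) j)) $$ (k, i) = 1\<^sub>m m $$ (k, i)"
    using diag off ki by auto
qed (auto simp: vandermonde_mat_def)

text \<open>With a = (x - z) g, comparing coefficients gives g_j = a_(j+1) + z g_(j+1). The descent
  starts at g_m = 0, and each step down adds at most \<open>c\<close> because |z| \<le> 1.\<close>

lemma coeff_linear_cofactor_le:
  fixes g :: "complex poly"
  assumes "degree g < m" "cmod z \<le> 1"
    and a: "\<And>k. k \<le> m \<Longrightarrow> cmod (coeff ([:- z, 1:] * g) k) \<le> c"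
  shows "j \<le> m \<Longrightarrow> cmod (coeff g j) \<le> real (m - j) * c"
proof (induction "m - j" arbitrary: j)
  case 0
  then show ?case using assms(1) by (simp add: coeff_eq_0)
next
  case (Suc d)
  have "cmod (coeff g (Suc j)) \<le> real (m - Suc j) * c"
    using Suc.hyps(1)[of "Suc j"] Suc.hyps(2) by linarith
  moreover have "cmod (coeff g j) = cmod (coeff ([:- z, 1:] * g) (Suc j) + z * coeff g (Suc j))"
    by simp
  moreover have "cmod (z * coeff g (Suc j)) \<le> cmod (coeff g (Suc j))"
    using assms(2) by (simp add: norm_mult mult_left_le_one_le)
  moreover have "cmod (coeff ([:- z, 1:] * g) (Suc j)) \<le> c"
    using Suc by (intro a) auto
  ultimately have "cmod (coeff g j) \<le> c + real (m - Suc j) * c"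
    using norm_triangle_ineq[of "coeff ([:- z, 1:] * g) (Suc j)" "z * coeff g (Suc j)"] by linarith
  also have "\<dots> = real (Suc (m - Suc j)) * c"
    by (simp add: algebra_simps)
  also have "Suc (m - Suc j) = m - j"
    using Suc by simp
  finally show ?case .
qed

text \<open>The columns of the inverse are the coefficient vectors of the Lagrange polynomials
  $f(x) / ((x - \zeta_i) f'(\zeta_i))$.\<close>

lemma mat_cond_vandermonde_le:
  fixes \<zeta> :: "nat \<Rightarrow> complex" and m :: nat
  defines "f \<equiv> \<Prod>i<m. [:- \<zeta> i, 1:]"
  assumes inj: "inj_on \<zeta> {..<m}"
    and unit: "\<And>i. i < m \<Longrightarrow> cmod (\<zeta> i) = 1"
    and c: "\<And>k. k \<le> m \<Longrightarrow> cmod (coeff f k) \<le> c" "0 \<le> c"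
    and d: "\<And>i. i < m \<Longrightarrow> d \<le> cmod (poly (pderiv f) (\<zeta> i))" "0 < d"
  shows "invertible_mat (vandermonde_mat m \<zeta>) \<and>
    mat_cond (vandermonde_mat m \<zeta>) \<le> real m ^ 3 * c / d"
proof -
  define g where "g = (\<lambda>i. \<Prod>k\<in>{..<m} - {i}. [:- \<zeta> k, 1:])"
  have f: "f = [:- \<zeta> i, 1:] * g i" if "i < m" for i
    unfolding f_def g_def using that by (subst prod.remove[of _ i]) auto
  have deg: "degree (g i) < m" if "i < m" for i
    unfolding g_def using that by (subst degree_prod_sum_eq) auto
  \<comment> \<open>In the product rule for (x - \<zeta>_i) g_i, the term keeping the linear factor
    vanishes at \<zeta>_i.\<close>
  have deriv: "poly (pderiv f) (\<zeta> i) = poly (g i) (\<zeta> i)" if "i < m" for i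
    unfolding f[OF that] pderiv_mult by (simp add: pderiv_pCons)
  have nz: "poly (g i) (\<zeta> i) \<noteq> 0" if "i < m" for i
    using d(1)[OF that] d(2) deriv[OF that] by auto
  have off: "poly (g i) (\<zeta> k) = 0" if "i < m" "k < m" "k \<noteq> i" for i k
    unfolding g_def poly_prod using that by (intro prod_zero) auto
  define G where "G = (\<lambda>i. smult (inverse (poly (g i) (\<zeta> i))) (g i))"
  define V where "V = vandermonde_mat m \<zeta>"
  define W where "W = mat m m (\<lambda>(j, i). coeff (G i) j)"
  have V: "V \<in> carrier_mat m m" and W: "W \<in> carrier_mat m m"
    by (auto simp: V_def W_def vandermonde_mat_def)
  have VW: "V * W = 1\<^sub>m m"
    unfolding V_def W_def using deg nz off
    by (intro vandermonde_mat_inverse) (auto simp: G_def)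
  have inv: "invertible_mat V"
    using V W VW mat_mult_left_right_inverse[OF V W VW]
    by (auto simp: invertible_mat_def inverts_mat_def)
  have "frobenius_norm V \<le> real m * 1"
    using unit by (intro frobenius_norm_le V) (auto simp: V_def vandermonde_mat_def norm_power)
  moreover have "frobenius_norm W \<le> real m * (real m * c / d)"
  proof (intro frobenius_norm_le W)
    show "0 \<le> real m * c / d" using c d by simp
    fix j i assume ji: "j < m" "i < m"
    have "cmod (coeff (g i) j) \<le> real (m - j) * c"
      using ji c(1) f[OF ji(2)] unit by (intro coeff_linear_cofactor_le[of _ m "\<zeta> i"] deg) auto
    also have "\<dots> \<le> real m * c"
      using c by (intro mult_right_mono) auto
    finally have "cmod (coeff (g i) j) / cmod (poly (g i) (\<zeta> i)) \<le> real m * c / d"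
      using c(2) d ji by (intro frac_le) (auto simp: deriv)
    then show "cmod (W $$ (j, i)) \<le> real m * c / d"
      using ji by (simp add: W_def G_def norm_mult norm_inverse divide_inverse mult.commute)
  qed
  \<comment> \<open>Each norm contributes a factor \<open>m\<close>; the third comes from the
    entrywise bound on \<open>W\<close>.\<close>
  ultimately have "frobenius_norm V * frobenius_norm W \<le> (real m * 1) * (real m * (real m * c / d))"
    by (intro mult_mono) (auto simp: frobenius_norm_def intro!: sum_nonneg)
  also have "\<dots> = real m ^ 3 * c / d"
    by (simp add: power3_eq_cube)
  finally show ?thesis
    using inv mat_inverse_eq_Some[OF V W VW] by (simp add: mat_cond_def V_def)
qed

section \<open>Cyclotomic polynomials with two prime divisors\<close>

text \<open>The derivative n x^(n-1) vanishes at most at 0, which is not a root, so all roots are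
  simple; the polynomial is monic.\<close>

lemma monom_minus_one_eq_prod:
  assumes "0 < n"
  shows "monom 1 n - 1 = (\<Prod>z | z ^ n = 1. [:- z, 1:] :: complex poly)"
proof -
  let ?p = "monom 1 n - 1 :: complex poly"
  have "rsquarefree ?p"
    using assms by (auto simp: rsquarefree_roots poly_monom pderiv_diff pderiv_monom power_0_left)
  then have "smult (lead_coeff ?p) (\<Prod>z | poly ?p z = 0. [:- z, 1:]) = ?p"
    by (rule complex_poly_decompose_rsquarefree)
  moreover have "degree ?p = n"
    using assms by (subst diff_conv_add_uminus, subst degree_add_eq_left) (auto simp: degree_monom_eq)
  ultimately show ?thesis
    using assms by (simp add: poly_monom)
qed

lemma power_eq_1_gcd:
  fixes z :: complex
  assumes "z ^ a = 1" "z ^ b = 1"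
  shows "z ^ gcd a b = 1"
proof (cases "a = 0")
  case False
  then obtain x y where "a * x = b * y + gcd a b"
    using bezout_nat by blast
  then have "(z ^ a) ^ x = (z ^ b) ^ y * z ^ gcd a b"
    by (metis power_add power_mult)
  then show ?thesis using assms by simp
qed (use assms in auto)

text \<open>A non-primitive root satisfies z^d = 1 for a proper divisor d of n. A prime t dividing
  n/d must be p or q, so d divides n/t, which is q s or p s. Conversely, p s and q s are smaller
  than n.\<close>

lemma non_primitive_roots_unity:
  assumes pq: "prime p" "prime q" and "p \<noteq> q" and n: "n = p * q * s" "0 < s"
    and s: "\<And>t. prime t \<Longrightarrow> t dvd s \<Longrightarrow> t = p \<or> t = q"
  shows "{z. z ^ n = 1} - primitive_roots_unity n = {z. z ^ (p * s) = 1} \<union> {z. z ^ (q * s) = 1}"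
proof (intro equalityI subsetI)
  fix z assume z: "z \<in> {z. z ^ n = 1} - primitive_roots_unity n"
  then obtain k where k: "0 < k" "k < n" "z ^ k = 1" "z ^ n = 1"
    by (auto simp: primitive_roots_unity_def)
  define d where "d = gcd k n"
  have zd: "z ^ d = 1"
    unfolding d_def using k by (intro power_eq_1_gcd)
  have "d \<le> k" "d dvd n"
    unfolding d_def using k by (auto intro: gcd_le1_nat)
  then obtain e where e: "n = d * e" by (elim dvdE)
  with \<open>d \<le> k\<close> k have "e \<noteq> 1" by auto
  then obtain t where t: "prime t" "t dvd e"
    using prime_factor_nat by blast
  then have "t dvd p * q * s" using e n by auto
  then have "t = p \<or> t = q"
    using t pq s by (auto simp: prime_dvd_mult_iff primes_dvd_imp_eq)
  moreover obtain e' where "e = t * e'" using t by (elim dvdE)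
  ultimately have "q * s = d * e' \<or> p * s = d * e'"
    using e n prime_gt_0_nat[OF pq(1)] prime_gt_0_nat[OF pq(2)]
    by (auto simp: mult_ac)
  then show "z \<in> {z. z ^ (p * s) = 1} \<union> {z. z ^ (q * s) = 1}"
    using zd by (auto simp: power_mult[of z d e'])
next
  fix z :: complex assume z: "z \<in> {z. z ^ (p * s) = 1} \<union> {z. z ^ (q * s) = 1}"
  have "z ^ n = (z ^ (p * s)) ^ q" "z ^ n = (z ^ (q * s)) ^ p"
    by (simp_all add: n flip: power_mult) (simp_all add: mult_ac)
  moreover have "0 < p * s" "0 < q * s" "p * s < n" "q * s < n"
    using n pq prime_gt_1_nat[OF pq(1)] prime_gt_1_nat[OF pq(2)] by auto
  ultimately show "z \<in> {z. z ^ n = 1} - primitive_roots_unity n"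
    using z unfolding primitive_roots_unity_def by fastforce
qed

text \<open>Multiplicative inclusion-exclusion over root sets: the non-primitive roots are a union
  of two sets that meet in the s-th roots of unity, since gcd(p s, q s) = s. The form without
  quotients avoids polynomial division.\<close>

lemma prod_primitive_roots_unity:
  assumes pq: "prime p" "prime q" and neq: "p \<noteq> q" and n: "n = p * q * s" "0 < s"
    and s: "\<And>t. prime t \<Longrightarrow> t dvd s \<Longrightarrow> t = p \<or> t = q"
  shows "(\<Prod>z\<in>primitive_roots_unity n. [:- z, 1:]) * (monom 1 (p * s) - 1) * (monom 1 (q * s) - 1) =
    (monom 1 n - 1) * (monom 1 s - 1)"
proof -
  let ?P = "\<lambda>A :: complex set. \<Prod>z\<in>A. [:- z, 1:]"
  let ?U = "\<lambda>k :: nat. {z :: complex. z ^ k = 1}"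
  have pos: "0 < p" "0 < q" "0 < n"
    using pq n by (auto simp: prime_gt_0_nat)
  have fin: "finite (?U k)" if "0 < k" for k
    using that by (simp add: finite_roots_unity)
  have "?U (p * s) \<inter> ?U (q * s) = ?U s"
  proof -
    have "gcd (p * s) (q * s) = s"
      using primes_coprime[OF pq neq] gcd_mult_distrib_nat[of s p q] by (simp add: mult.commute)
    then show ?thesis
      using power_eq_1_gcd[of _ "p * s" "q * s"] by (auto simp: power_mult mult.commute[of _ s])
  qed
  moreover have "?P (?U (p * s) \<union> ?U (q * s)) * ?P (?U (p * s) \<inter> ?U (q * s)) =
      ?P (?U (p * s)) * ?P (?U (q * s))"
    using pos n(2) by (intro prod.union_inter fin) auto
  ultimately have cup: "?P (?U (p * s)) * ?P (?U (q * s)) = ?P (?U (p * s) \<union> ?U (q * s)) * ?P (?U s)"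
    by simp
  have "primitive_roots_unity n \<subseteq> ?U n"
    by (auto simp: primitive_roots_unity_def)
  then have "?P (?U n) = ?P (?U n - primitive_roots_unity n) * ?P (primitive_roots_unity n)"
    using fin[OF pos(3)] by (intro prod.subset_diff)
  then have diff: "?P (?U n) = ?P (?U (p * s) \<union> ?U (q * s)) * ?P (primitive_roots_unity n)"
    by (simp only: non_primitive_roots_unity[OF assms])
  have "monom 1 k - 1 = ?P (?U k)" if "k \<in> {p * s, q * s, s, n}" for k
    using that pos n(2) by (intro monom_minus_one_eq_prod) auto
  then show ?thesis
    by (simp add: diff cup mult.assoc)
qed

section \<open>Coefficient and derivative bounds for Phi_n\<close>

lemma monom_minus_one_factor:
  "monom 1 (k * n) - 1 = (monom 1 k - 1) * (\<Sum>i<n. monom 1 (k * i) :: 'a::comm_ring_1 poly)"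
  using power_diff_1_eq[of "monom 1 k :: 'a poly" n] by (simp add: monom_power mult.commute)

text \<open>The exponents \<open>k * i\<close> are pairwise distinct, so no two terms add
  up.\<close>

lemma coeff_sum_monom_multiples:
  assumes "0 < k"
  shows "coeff (\<Sum>i<n. monom 1 (k * i) :: 'a::comm_ring_1 poly) j \<in> {0, 1}"
proof -
  have "coeff (\<Sum>i<n. monom 1 (k * i) :: 'a poly) j = (\<Sum>i<n. if k * i = j then 1 else 0)"
    by (simp add: coeff_sum)
  also have "\<dots> = (\<Sum>i | i < n \<and> k * i = j. 1)"
    by (subst sum.inter_filter[symmetric]) auto
  also have "{i. i < n \<and> k * i = j} = (if k dvd j \<and> j div k < n then {j div k} else {})"
    using assms by auto
  finally show ?thesis by auto
qed

lemma coeff_monom_minus_one_mult: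
  "coeff ((monom 1 k - 1) * f) j = (if k \<le> j then coeff f (j - k) else 0) - coeff (f :: 'a::comm_ring_1 poly) j"
  by (simp add: left_diff_distrib coeff_monom_mult)

text \<open>Coefficients of \<open>f\<close> at distance \<open>k\<close> differ by at most 1, and
  \<open>j div k + 1\<close> steps of length \<open>k\<close> lead from \<open>j\<close> to a
  negative index, where the coefficient counts as 0.\<close>

lemma coeff_le_of_periodic_quotient:
  fixes f :: "complex poly"
  assumes "0 < k" and "\<And>j. cmod (coeff ((monom 1 k - 1) * f) j) \<le> 1"
  shows "cmod (coeff f j) \<le> real (j div k + 1)"
proof (induction j rule: less_induct)
  case (less j)
  have j: "cmod ((if k \<le> j then coeff f (j - k) else 0) - coeff f j) \<le> 1"
    using assms(2)[of j] unfolding coeff_monom_minus_one_mult .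
  show ?case
  proof (cases "k \<le> j")
    case True
    have "cmod (coeff f (j - k)) \<le> real ((j - k) div k + 1)"
      using True assms by (intro less) auto
    moreover have "j div k = (j - k) div k + 1"
      using True assms by (simp add: le_div_geq)
    moreover have "cmod (coeff f j) - cmod (coeff f (j - k)) \<le> 1"
      using j True norm_triangle_ineq2[of "coeff f j" "coeff f (j - k)"] by (simp add: norm_minus_commute)
    ultimately show ?thesis by simp
  qed (use j in auto)
qed

text \<open>The quotient (z^k - 1) / (z - 1) is a geometric sum of k terms of modulus at most
  1.\<close>

lemma cmod_power_minus_one_le:
  assumes "cmod z \<le> 1"
  shows "cmod (z ^ k - 1) \<le> real k * cmod (z - 1)"
  using norm_power_diff[of z 1 k] assms by simp

text \<open>Writing $\omega = z^s$, the two bounds come from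
  $f \cdot (x^{qs} - 1) = (x^s - 1) \sum_{i<q} x^{ips}$ and from
  $|f'(z)| \cdot |\omega^p - 1| \cdot |\omega^q - 1| = n |\omega - 1|$.\<close>

lemma cyclotomic_two_primes_bounds:
  fixes n :: nat
  assumes pq: "prime p" "prime q" and neq: "p \<noteq> q" and n: "n = p * q * s" "0 < s"
    and s: "\<And>t. prime t \<Longrightarrow> t dvd s \<Longrightarrow> t = p \<or> t = q"
  defines "f \<equiv> \<Prod>z\<in>primitive_roots_unity n. [:- z, 1:]"
  shows "k < n \<Longrightarrow> cmod (coeff f k) \<le> real p"
    and "z \<in> primitive_roots_unity n \<Longrightarrow> real (q * s) / 2 \<le> cmod (poly (pderiv f) z)"
proof -
  have pos: "1 < p" "1 < q" "0 < n"
    using n prime_gt_1_nat[OF pq(1)] prime_gt_1_nat[OF pq(2)] by auto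
  have main: "f * (monom 1 (p * s) - 1) * (monom 1 (q * s) - 1) = (monom 1 n - 1) * (monom 1 s - 1)"
    unfolding f_def using assms(1-6) by (rule prod_primitive_roots_unity)
  {
    assume k: "k < n"
    define A :: "complex poly" where "A = (\<Sum>i<q. monom 1 (p * s * i))"
    have "monom 1 n - 1 = (monom 1 (p * s) - 1) * A"
      using monom_minus_one_factor[of "p * s" q] by (simp add: A_def n mult_ac)
    then have "(monom 1 (p * s) - 1) * ((monom 1 (q * s) - 1) * f) =
        (monom 1 (p * s) - 1) * ((monom 1 s - 1) * A)"
      using main by (simp add: mult_ac)
    moreover have "monom 1 (p * s) \<noteq> (1 :: complex poly)"
      using pos n by (simp add: monom_eq_1_iff)
    ultimately have eq: "(monom 1 (q * s) - 1) * f = (monom 1 s - 1) * A"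
      by simp
    have A: "coeff A j \<in> {0, 1}" for j
      unfolding A_def using pos n by (intro coeff_sum_monom_multiples) auto
    \<comment> \<open>Each coefficient of (x^s - 1) A is a difference of two numbers from {0,
      1}.\<close>
    have "cmod (coeff ((monom 1 (q * s) - 1) * f) j) \<le> 1" for j
      unfolding eq coeff_monom_minus_one_mult using A[of j] A[of "j - s"] by auto
    then have "cmod (coeff f k) \<le> real (k div (q * s) + 1)"
      using pos n by (intro coeff_le_of_periodic_quotient) auto
    \<comment> \<open>Since k < n = p (q s), the quotient is at most p - 1, and the extra 1 gives
      exactly p.\<close>
    also have "k div (q * s) < p"
      using k n by (simp add: less_mult_imp_div_less mult_ac)
    then have "real (k div (q * s) + 1) \<le> real p" by linarith
    finally show "cmod (coeff f k) \<le> real p" .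
  }
  assume z: "z \<in> primitive_roots_unity n"
  then have zn: "z ^ n = 1" and prim: "\<And>k. 0 < k \<Longrightarrow> k < n \<Longrightarrow> z ^ k \<noteq> 1"
    by (auto simp: primitive_roots_unity_def)
  have norm: "cmod z = 1"
    using power_eq_1_iff[OF zn] pos by simp
  have fz: "poly f z = 0"
    using z finite_roots_unity[of n, where 'a = complex] pos
    by (auto simp: f_def poly_prod primitive_roots_unity_def intro!: prod_zero)
  have "poly (pderiv (f * (monom 1 (p * s) - 1) * (monom 1 (q * s) - 1))) z =
      poly (pderiv ((monom 1 n - 1) * (monom 1 s - 1))) z"
    by (simp only: main)
  \<comment> \<open>As f(z) = 0 and z^n = 1, only the term that differentiates the vanishing factor
    survives on each side.\<close>
  then have "poly (pderiv f) z * (z ^ (p * s) - 1) * (z ^ (q * s) - 1) =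
      of_nat n * z ^ (n - 1) * (z ^ s - 1)"
    using fz zn by (simp add: pderiv_mult pderiv_diff pderiv_monom poly_monom mult_ac)
  from arg_cong[OF this[symmetric], of cmod]
  have "real n * cmod (z ^ s - 1) =
      cmod (poly (pderiv f) z) * cmod (z ^ (p * s) - 1) * cmod (z ^ (q * s) - 1)"
    using norm by (simp only: norm_mult norm_power norm_of_nat power_one mult_1_right)
  \<comment> \<open>Only one factor is compared with |\<omega> - 1|, at cost p; the other is bounded
    trivially by 2. This leaves n / (2 p) = q s / 2.\<close>
  also have "\<dots> \<le>
      cmod (poly (pderiv f) z) * (real p * cmod (z ^ s - 1)) * 2"
  proof (intro mult_mono)
    show "cmod (z ^ (p * s) - 1) \<le> real p * cmod (z ^ s - 1)"
      using cmod_power_minus_one_le[of "z ^ s" p] norm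
      by (simp add: norm_power mult.commute flip: power_mult)
    show "cmod (z ^ (q * s) - 1) \<le> 2"
      using norm_triangle_ineq4[of "z ^ (q * s)" 1] norm by (simp add: norm_power)
  qed auto
  finally have "cmod (z ^ s - 1) * (real p * real (q * s)) \<le>
      cmod (z ^ s - 1) * (real p * (cmod (poly (pderiv f) z) * 2))"
    by (simp add: n mult_ac)
  \<comment> \<open>Primitivity then makes z^s - 1 nonzero, so its modulus can be cancelled.\<close>
  moreover have "s < n"
    using n less_1_mult[OF pos(1,2)] by simp
  then have "cmod (z ^ s - 1) > 0"
    using prim[OF n(2)] by simp
  ultimately show "real (q * s) / 2 \<le> cmod (poly (pderiv f) z)"
    using pos by simp
qed

section \<open>The bound for n = p^r q^l\<close>

lemma mat_cond_vandermonde_two_primes: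
  assumes pq: "prime p" "prime q" "p < q" and rl: "1 \<le> r" "1 \<le> l"
    and n: "n = p ^ r * q ^ l" and m: "m = totient n"
    and \<zeta>: "bij_betw \<zeta> {..<m} (primitive_roots_unity n)"
  shows "invertible_mat (vandermonde_mat m \<zeta>) \<and>
    mat_cond (vandermonde_mat m \<zeta>) \<le> 2 * real (totient (rad n)) * real m ^ 2"
proof -
  \<comment> \<open>This is n / rad(n); it brings in no primes besides p and q.\<close>
  define s where "s = p ^ (r - 1) * q ^ (l - 1)"
  have pos: "1 < p" "1 < q"
    using prime_gt_1_nat[OF pq(1)] prime_gt_1_nat[OF pq(2)] by auto
  have s0: "0 < s"
    using pos by (simp add: s_def)
  have ns: "n = p * q * s"
    unfolding n s_def using rl by (cases r; cases l) (auto simp: mult_ac)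
  have sdvd: "t = p \<or> t = q" if "prime t" "t dvd s" for t
  proof -
    have "t dvd p \<or> t dvd q"
      using that unfolding s_def by (metis prime_dvd_mult_iff prime_dvd_power)
    then show ?thesis
      using that pq by (auto simp: primes_dvd_imp_eq)
  qed
  have cop: "coprime p q"
    using pq by (intro primes_coprime) auto
  have tot: "totient (p * q) = (p - 1) * (q - 1)"
    using cop pq by (simp add: totient_mult_coprime totient_prime)
  have "totient n = (p ^ (r - 1) * (p - 1)) * (q ^ (l - 1) * (q - 1))"
    unfolding n using cop pq rl by (subst totient_mult_coprime) (auto simp: totient_prime_power)
  then have ms: "m = s * totient (p * q)"
    by (simp add: m s_def tot mult_ac)
  have "prime_factors n = {p, q}"
    unfolding n using pq rl by (simp add: prime_factors_product prime_factors_power prime_factorization_prime insert_commute)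
  then have rad: "rad n = p * q"
    using pq by (simp add: rad_def)
  \<comment> \<open>The coefficient bound holds below n, so it covers every index up to m.\<close>
  have "m < n"
    unfolding m using less_le_trans[OF less_1_mult[OF pos], of n] ns s0 by (intro totient_less) auto
  define f where "f = (\<Prod>z\<in>primitive_roots_unity n. [:- z, 1:])"
  have f: "(\<Prod>i<m. [:- \<zeta> i, 1:]) = f"
    unfolding f_def using prod.reindex_bij_betw[OF \<zeta>] .
  have mem: "\<zeta> i \<in> primitive_roots_unity n" if "i < m" for i
    using \<zeta> that by (auto simp: bij_betw_def)
  note bounds = cyclotomic_two_primes_bounds[OF pq(1,2) less_imp_neq[OF pq(3)] ns s0 sdvd, folded f_def]
  have "invertible_mat (vandermonde_mat m \<zeta>) \<and>
      mat_cond (vandermonde_mat m \<zeta>) \<le> real m ^ 3 * real p / (real (q * s) / 2)"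
  proof (rule mat_cond_vandermonde_le, unfold f)
    show "inj_on \<zeta> {..<m}" using \<zeta> by (simp add: bij_betw_def)
    show "cmod (\<zeta> i) = 1" if "i < m" for i
    proof -
      have "\<zeta> i ^ n = 1" using mem[OF that] by (simp add: primitive_roots_unity_def)
      then show ?thesis
        using power_eq_1_iff[of "\<zeta> i" n] \<open>m < n\<close> by simp
    qed
    show "cmod (coeff f k) \<le> real p" if "k \<le> m" for k
      using that \<open>m < n\<close> by (intro bounds) auto
    show "real (q * s) / 2 \<le> cmod (poly (pderiv f) (\<zeta> i))" if "i < m" for i
      using that by (intro bounds mem)
  qed (use pos s0 in auto)
  \<comment> \<open>One factor m of m^3 is written as s phi(p q), and its s cancels. The remaining p
    / q is below 1 because p < q.\<close>
  moreover have "real m ^ 3 * real p / (real (q * s) / 2) = 2 * real (totient (p * q)) * real m ^ 2 * (real p / real q)"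
    using s0 by (simp add: power3_eq_cube power2_eq_square ms)
  moreover have "\<dots> \<le> 2 * real (totient (p * q)) * real m ^ 2 * 1"
    using pq by (intro mult_left_mono) auto
  ultimately show ?thesis
    by (auto simp: rad)
qed

text \<open>Invertibility is claimed as well because \<open>mat_cond\<close> is meaningful only for
  invertible matrices. The claim is symmetric in (p, r) and (q, l), so p < q may be assumed.\<close>

theorem theorem4p3:
  fixes p q r l n m :: nat and \<zeta> :: "nat \<Rightarrow> complex"
  assumes "prime p" "odd p" "prime q" "odd q" "p \<noteq> q"
    and "r \<ge> 1" "l \<ge> 1"
    and "n = p ^ r * q ^ l" "m = totient n"
    and "bij_betw \<zeta> {..<m} (primitive_roots_unity n)"
  shows "invertible_mat (vandermonde_mat m \<zeta>) \<and>
    mat_cond (vandermonde_mat m \<zeta>) \<le> 2 * real (totient (rad n)) * real m ^ 2"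
proof (cases "p < q")
  case True
  then show ?thesis
    using assms by (intro mat_cond_vandermonde_two_primes[of p q r l]) auto
next
  case False
  then show ?thesis
    using assms by (intro mat_cond_vandermonde_two_primes[of q p l r]) (auto simp: mult.commute)
qed

end
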